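(* For every integer $e\ge 3$ there exists a strongly equitable $2$-chromatic $e$-star system of order $2e$, i.e. a $2$-chromatic $e$-star system of order $2e$ admitting a $2$-colouring whose two colour classes each have exactly $e$ vertices.
   Context: An $e$-star is the complete bipartite graph $K_{1,e}$. An $e$-star system of order $n$ is a pair $(V,\mathcal B)$ where $|V|=n$ and $\mathcal B$ is a set of $e$-stars (subgraphs of the complete graph $K_n$ on $V$) whose edge sets partition the edge set of $K_n$. An $e$-star system is $k$-colourable if $V$ can be partitioned into $k$ sets (colour classes) such that no star in $\mathcal B$ has all its vertices in the same class; it is $k$-chromatic if it is $k$-colourable but not $(k-1)$-colourable. A colouring is strongly equitable if all colour classes have the same size; a system is strongly equitable $k$-chromatic if it is $k$-chromatic and admits a strongly equitable $k$-colouring. *)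

theory Defs
  imports Main "HOL-Library.Disjoint_Sets"
begin

datatype 'a ugraph = Ugraph (verts: "'a set") (edges: "'a set set")

definition subgraph :: "'a ugraph \<Rightarrow> 'a ugraph \<Rightarrow> bool" where
  "subgraph H G \<longleftrightarrow> verts H \<subseteq> verts G \<and> edges H \<subseteq> edges G"

definition complete_graph :: "'a set \<Rightarrow> 'a ugraph" where
  "complete_graph V = Ugraph V {{u, v} | u v. u \<in> V \<and> v \<in> V \<and> u \<noteq> v}"

definition is_complete_bipartite :: "nat \<Rightarrow> nat \<Rightarrow> 'a ugraph \<Rightarrow> bool" where
  "is_complete_bipartite m n G \<longleftrightarrow>
     (\<exists>X Y. finite X \<and> finite Y \<and> card X = m \<and> card Y = n \<and> X \<inter> Y = {} \<and>
        verts G = X \<union> Y \<and> edges G = {{x, y} | x y. x \<in> X \<and> y \<in> Y})"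

definition is_star :: "nat \<Rightarrow> 'a ugraph \<Rightarrow> bool" where
  "is_star e S \<longleftrightarrow> is_complete_bipartite 1 e S"

definition star_system :: "nat \<Rightarrow> nat \<Rightarrow> 'a set \<Rightarrow> 'a ugraph set \<Rightarrow> bool" where
  "star_system e n V B \<longleftrightarrow>
     finite V \<and> card V = n \<and>
     (\<forall>S\<in>B. is_star e S \<and> subgraph S (complete_graph V)) \<and>
     disjoint_family_on edges B \<and> (\<Union>S\<in>B. edges S) = edges (complete_graph V)"

(* The colour classes are the members of P; partition_on makes them nonempty. *)
definition is_colouring :: "nat \<Rightarrow> 'a set \<Rightarrow> 'a ugraph set \<Rightarrow> 'a set set \<Rightarrow> bool" where
  "is_colouring k V B P \<longleftrightarrow>
     partition_on V P \<and> finite P \<and> card P = k \<and> (\<forall>S\<in>B. \<not> (\<exists>C\<in>P. verts S \<subseteq> C))"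

definition colourable :: "nat \<Rightarrow> 'a set \<Rightarrow> 'a ugraph set \<Rightarrow> bool" where
  "colourable k V B \<longleftrightarrow> (\<exists>P. is_colouring k V B P)"

definition chromatic :: "nat \<Rightarrow> 'a set \<Rightarrow> 'a ugraph set \<Rightarrow> bool" where
  "chromatic k V B \<longleftrightarrow> colourable k V B \<and> \<not> colourable (k - 1) V B"

definition strongly_equitable :: "'a set set \<Rightarrow> bool" where
  "strongly_equitable P \<longleftrightarrow> (\<forall>C\<in>P. \<forall>D\<in>P. card C = card D)"

definition strongly_equitable_chromatic :: "nat \<Rightarrow> 'a set \<Rightarrow> 'a ugraph set \<Rightarrow> bool" where
  "strongly_equitable_chromatic k V B \<longleftrightarrow>
     chromatic k V B \<and> (\<exists>P. is_colouring k V B P \<and> strongly_equitable P)"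

end

theory Submission
  imports Defs
begin

text \<open>
  An $e$-star has $e + 1$ vertices, so no partition into classes of size $e$ contains a
  monochromatic star; hence every $e$-star system of order $2e$ is strongly equitable 2-chromatic.
  Such a system is read off a tournament on $2e$ vertices in which one vertex is a sink and all
  others have out-degree $e$: take a circulant regular tournament on $2e - 1$ vertices, of
  out-degree $e - 1$, and add a sink.
\<close>

definition star :: "'a \<Rightarrow> 'a set \<Rightarrow> 'a ugraph" where
  "star c L = Ugraph (insert c L) {{c, y} | y. y \<in> L}"

lemma verts_star [simp]: "verts (star c L) = insert c L"
  by (simp add: star_def)

lemma edges_star [simp]: "edges (star c L) = {{c, y} | y. y \<in> L}"
  by (simp add: star_def)

lemma is_star_star:
  assumes "finite L" "c \<notin> L"
  shows "is_star (card L) (star c L)"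
  unfolding is_star_def is_complete_bipartite_def
  by (intro exI[of _ "{c}"] exI[of _ L]) (use assms in auto)

lemma doubleton_mem_edges_complete_graph_iff [simp]:
  "{u, v} \<in> edges (complete_graph V) \<longleftrightarrow> u \<in> V \<and> v \<in> V \<and> u \<noteq> v"
  by (auto simp: complete_graph_def doubleton_eq_iff)

lemma verts_complete_graph [simp]: "verts (complete_graph V) = V"
  by (simp add: complete_graph_def)

lemma subgraph_star_complete_graph:
  assumes "c \<in> V" "L \<subseteq> V - {c}"
  shows "subgraph (star c L) (complete_graph V)"
  using assms by (auto simp: subgraph_def)

lemma card_verts_if_is_star:
  assumes "is_star e S"
  shows "card (verts S) = Suc e"
proof -
  obtain X Y where "finite X" "finite Y" "card X = 1" "card Y = e" "X \<inter> Y = {}" "verts S = X \<union> Y"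
    using assms unfolding is_star_def is_complete_bipartite_def by (elim exE conjE) (rule that)
  then show ?thesis by (simp add: card_Un_disjoint)
qed

definition tournament :: "'a set \<Rightarrow> ('a \<Rightarrow> 'a set) \<Rightarrow> bool" where
  "tournament V out \<longleftrightarrow>
     (\<forall>u\<in>V. out u \<subseteq> V - {u}) \<and> (\<forall>u\<in>V. \<forall>v\<in>V. u \<noteq> v \<longrightarrow> (v \<in> out u \<longleftrightarrow> u \<notin> out v))"

lemma tournament_out_subset: "tournament V out \<Longrightarrow> u \<in> V \<Longrightarrow> out u \<subseteq> V - {u}"
  unfolding tournament_def by blast

lemma tournament_mem_out_iff:
  "tournament V out \<Longrightarrow> u \<in> V \<Longrightarrow> v \<in> V \<Longrightarrow> u \<noteq> v \<Longrightarrow> v \<in> out u \<longleftrightarrow> u \<notin> out v"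
  unfolding tournament_def by blast

definition out_stars :: "'a set \<Rightarrow> ('a \<Rightarrow> 'a set) \<Rightarrow> 'a ugraph set" where
  "out_stars V out = (\<lambda>u. star u (out u)) ` {u \<in> V. out u \<noteq> {}}"

lemma disjoint_family_on_edges_out_stars:
  assumes "tournament V out"
  shows "disjoint_family_on edges (out_stars V out)"
  unfolding disjoint_family_on_def
proof (intro ballI impI)
  fix S T assume "S \<in> out_stars V out" "T \<in> out_stars V out" "S \<noteq> T"
  then obtain u v where uv: "u \<in> V" "v \<in> V" "u \<noteq> v"
    and ST: "S = star u (out u)" "T = star v (out v)"
    unfolding out_stars_def by blast
  have "\<not> (v \<in> out u \<and> u \<in> out v)"
    using tournament_mem_out_iff[OF assms uv] by blast
  with \<open>u \<noteq> v\<close> show "edges S \<inter> edges T = {}"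
    by (auto simp: ST doubleton_eq_iff)
qed

lemma subgraph_out_stars_complete_graph:
  assumes "tournament V out" "S \<in> out_stars V out"
  shows "subgraph S (complete_graph V)"
proof -
  obtain u where "u \<in> V" "S = star u (out u)"
    using assms(2) by (auto simp: out_stars_def)
  then show ?thesis
    using subgraph_star_complete_graph tournament_out_subset[OF assms(1)] by metis
qed

lemma UN_edges_out_stars:
  assumes "tournament V out"
  shows "(\<Union>S\<in>out_stars V out. edges S) = edges (complete_graph V)"
proof
  show "(\<Union>S\<in>out_stars V out. edges S) \<subseteq> edges (complete_graph V)"
    using subgraph_out_stars_complete_graph[OF assms] unfolding subgraph_def by blast
  show "edges (complete_graph V) \<subseteq> (\<Union>S\<in>out_stars V out. edges S)"
  proof
    fix x assume "x \<in> edges (complete_graph V)"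
    then obtain u v where x: "x = {u, v}" and uv: "u \<in> V" "v \<in> V" "u \<noteq> v"
      by (auto simp: complete_graph_def)
    then consider "v \<in> out u" | "u \<in> out v"
      using tournament_mem_out_iff[OF assms] by blast
    then show "x \<in> (\<Union>S\<in>out_stars V out. edges S)"
      using uv by cases (auto simp: x out_stars_def insert_commute)
  qed
qed

lemma star_system_out_stars:
  assumes "finite V" "tournament V out"
    and "\<And>u. u \<in> V \<Longrightarrow> out u \<noteq> {} \<Longrightarrow> card (out u) = e"
  shows "star_system e (card V) V (out_stars V out)"
proof -
  have "is_star e S" if S: "S \<in> out_stars V out" for S
  proof -
    obtain u where u: "u \<in> V" "card (out u) = e" "S = star u (out u)"
      using S assms(3) by (auto simp: out_stars_def)
    have "out u \<subseteq> V - {u}"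
      using assms(2) u(1) by (rule tournament_out_subset)
    then have "finite (out u)" "u \<notin> out u"
      using assms(1) finite_subset by auto
    then show ?thesis
      using is_star_star[of "out u" u] u(2,3) by simp
  qed
  then show ?thesis
    using assms(1) subgraph_out_stars_complete_graph[OF assms(2)]
      disjoint_family_on_edges_out_stars[OF assms(2)] UN_edges_out_stars[OF assms(2)]
    by (simp add: star_system_def)
qed

definition add_sink :: "'a \<Rightarrow> ('a \<Rightarrow> 'a set) \<Rightarrow> 'a \<Rightarrow> 'a set" where
  "add_sink s out u = (if u = s then {} else insert s (out u))"

lemma tournament_add_sink:
  assumes "tournament V out" "s \<notin> V"
  shows "tournament (insert s V) (add_sink s out)"
  unfolding tournament_def
proof (intro conjI ballI impI)
  show "add_sink s out u \<subseteq> insert s V - {u}" if "u \<in> insert s V" for u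
    using that assms(2) tournament_out_subset[OF assms(1), of u] by (auto simp: add_sink_def)
  show "v \<in> add_sink s out u \<longleftrightarrow> u \<notin> add_sink s out v"
    if "u \<in> insert s V" "v \<in> insert s V" "u \<noteq> v" for u v
    using that tournament_mem_out_iff[OF assms(1), of u v] by (simp add: add_sink_def) blast
qed

lemma star_system_add_sink:
  assumes "finite V" "tournament V out" "s \<notin> V"
    and regular: "\<And>u. u \<in> V \<Longrightarrow> card (out u) = d"
  shows "star_system (Suc d) (Suc (card V)) (insert s V) (out_stars (insert s V) (add_sink s out))"
proof -
  have "card (add_sink s out u) = Suc d" if "u \<in> insert s V" "add_sink s out u \<noteq> {}" for u
  proof -
    have u: "u \<in> V" "u \<noteq> s"
      using that by (auto simp: add_sink_def)
    then have "out u \<subseteq> V"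
      using tournament_out_subset[OF assms(2)] by blast
    then have "finite (out u)" "s \<notin> out u"
      using assms(1,3) finite_subset by auto
    then show ?thesis
      using u regular by (simp add: add_sink_def)
  qed
  then show ?thesis
    using star_system_out_stars[OF _ tournament_add_sink[OF assms(2,3)]] assms(1,3) by simp
qed

definition circulant :: "nat \<Rightarrow> nat set \<Rightarrow> nat \<Rightarrow> nat set" where
  "circulant n A i = (\<lambda>k. (i + k) mod n) ` A"

lemma cyclic_shift_inverse:
  fixes i k n :: nat
  assumes "i < n" "k < n"
  shows "((i + k) mod n + n - i) mod n = k"
proof -
  have "((i + k) mod n + n - i) mod n = ((i + k) mod n + (n - i)) mod n"
    using assms by simp
  also have "\<dots> = (i + k + (n - i)) mod n"
    by (rule mod_add_left_eq)
  also have "i + k + (n - i) = k + n"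
    using assms by simp
  finally show ?thesis
    using assms by simp
qed

lemma card_circulant:
  assumes "A \<subseteq> {..<n}" "i < n"
  shows "card (circulant n A i) = card A"
proof -
  have "inj_on (\<lambda>k. (i + k) mod n) A"
    using assms cyclic_shift_inverse
    by (intro inj_on_inverseI[where g = "\<lambda>j. (j + n - i) mod n"]) blast
  then show ?thesis
    by (simp add: circulant_def card_image)
qed

lemma mem_circulant_iff:
  assumes "A \<subseteq> {..<n}" "i < n" "j < n"
  shows "j \<in> circulant n A i \<longleftrightarrow> (j + n - i) mod n \<in> A"
proof
  assume "j \<in> circulant n A i"
  then show "(j + n - i) mod n \<in> A"
    using assms cyclic_shift_inverse by (auto simp: circulant_def)
next
  assume "(j + n - i) mod n \<in> A"
  moreover have "(i + (j + n - i) mod n) mod n = (i + (j + n - i)) mod n"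
    by (rule mod_add_right_eq)
  then have "j = (i + (j + n - i) mod n) mod n"
    using assms by simp
  ultimately show "j \<in> circulant n A i"
    unfolding circulant_def by (rule rev_image_eqI)
qed

lemma cyclic_difference_eq_if:
  fixes i j n :: nat
  assumes "i < n" "j < n"
  shows "(j + n - i) mod n = (if i \<le> j then j - i else n - (i - j))"
proof (cases "i \<le> j")
  case True
  then have "(j + n - i) mod n = (j - i + n) mod n"
    by simp
  also have "\<dots> = (j - i) mod n"
    by (rule mod_add_self2)
  finally show ?thesis
    using True assms by simp
next
  case False
  then show ?thesis
    using assms by simp
qed

lemma tournament_circulant:
  assumes "A \<subseteq> {0<..<n}" and "\<And>k. k \<in> {0<..<n} \<Longrightarrow> n - k \<in> A \<longleftrightarrow> k \<notin> A"
  shows "tournament {..<n} (circulant n A)"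
proof -
  have A: "A \<subseteq> {..<n}" "0 \<notin> A"
    using assms(1) by auto
  have "circulant n A i \<subseteq> {..<n} - {i}" if "i < n" for i
  proof -
    have "i \<notin> circulant n A i"
      using A(2) that mem_circulant_iff[OF A(1) that that] by simp
    moreover have "circulant n A i \<subseteq> {..<n}"
      using that by (auto simp: circulant_def)
    ultimately show ?thesis
      by blast
  qed
  moreover have "j \<in> circulant n A i \<longleftrightarrow> i \<notin> circulant n A j"
    if "i < n" "j < n" "i \<noteq> j" for i j
  proof -
    define k where "k = (j + n - i) mod n"
    have "k \<in> {0<..<n}" and reverse: "(i + n - j) mod n = n - k"
      using that by (auto simp: k_def cyclic_difference_eq_if)
    then have "k \<in> A \<longleftrightarrow> n - k \<notin> A"
      using assms(2) by blast
    with reverse show ?thesis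
      using that by (simp add: mem_circulant_iff[OF A(1)] k_def)
  qed
  ultimately show ?thesis
    unfolding tournament_def by blast
qed

lemma ex_star_system_of_double_order:
  assumes "e \<ge> 1"
  shows "\<exists>(V :: nat set) B. star_system e (2 * e) V B"
proof -
  define n where "n = 2 * e - 1"
  have "tournament {..<n} (circulant n {1..<e})"
    by (rule tournament_circulant) (auto simp: n_def)
  moreover have "card (circulant n {1..<e} i) = e - 1" if "i < n" for i
    using that by (subst card_circulant) (auto simp: n_def)
  ultimately have "star_system (Suc (e - 1)) (Suc (card {..<n})) (insert n {..<n})
      (out_stars (insert n {..<n}) (add_sink n (circulant n {1..<e})))"
    by (intro star_system_add_sink) simp_all
  moreover have "Suc (e - 1) = e" "Suc (card {..<n}) = 2 * e"
    using assms by (simp_all add: n_def)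
  ultimately show ?thesis
    by metis
qed

lemma ex_partition_on_card_eq:
  assumes "finite V" "card V = k * e" "e \<ge> 1"
  shows "\<exists>P. partition_on V P \<and> card P = k \<and> (\<forall>C\<in>P. card C = e)"
  using assms(1,2)
proof (induction k arbitrary: V)
  case 0
  then show ?case
    by (auto simp: partition_on_empty)
next
  case (Suc k)
  then have "e \<le> card V"
    by simp
  then obtain D where D: "D \<subseteq> V" "card D = e" "finite D"
    by (rule obtain_subset_with_card_n)
  then have "card (V - D) = k * e"
    using Suc.prems by (simp add: card_Diff_subset)
  then obtain P where P: "partition_on (V - D) P" "card P = k" "\<forall>C\<in>P. card C = e"
    using Suc.IH Suc.prems(1) by blast
  have "D \<noteq> {}"
    using D(2) assms(3) by auto
  then have "partition_on V (insert D P)"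
    using P(1) D(1) by (subst partition_on_insert) (auto dest: partition_onD1 simp: disjnt_def)
  moreover have "D \<notin> P"
    using \<open>D \<noteq> {}\<close> partition_onD1[OF P(1)] by blast
  moreover have "finite P"
    using P(1) Suc.prems(1) finite_elements by blast
  ultimately show ?case
    using D(2) P(2,3) by (intro exI[of _ "insert D P"]) simp
qed

lemma is_colouring_of_small_classes:
  assumes "star_system e n V B" "partition_on V P"
    and small: "\<And>C. C \<in> P \<Longrightarrow> card C \<le> e"
  shows "is_colouring (card P) V B P"
proof -
  have V: "finite V" and star: "\<And>S. S \<in> B \<Longrightarrow> is_star e S"
    using assms(1) by (auto simp: star_system_def)
  have "\<not> verts S \<subseteq> C" if "S \<in> B" "C \<in> P" for S C
  proof
    assume "verts S \<subseteq> C"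
    moreover have "finite C"
      using V partition_onD1[OF assms(2)] that(2) by (metis Sup_upper finite_subset)
    ultimately have "Suc e \<le> card C"
      using card_verts_if_is_star[OF star[OF that(1)]] card_mono by metis
    with small[OF that(2)] show False
      by simp
  qed
  then show ?thesis
    using assms(2) finite_elements[OF V assms(2)] by (auto simp: is_colouring_def)
qed

lemma ex_equitable_colouring:
  assumes "star_system e (k * e) V B" "e \<ge> 1"
  shows "\<exists>P. is_colouring k V B P \<and> (\<forall>C\<in>P. card C = e)"
proof -
  obtain P where "partition_on V P" "card P = k" "\<forall>C\<in>P. card C = e"
    using assms ex_partition_on_card_eq[of V k e] by (auto simp: star_system_def)
  then show ?thesis
    using is_colouring_of_small_classes[OF assms(1)] by fastforce
qed

lemma star_system_blocks_nonempty:
  assumes "star_system e n V B" "n \<ge> 2"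
  shows "B \<noteq> {}"
proof -
  obtain u v where "u \<in> V" "v \<in> V" "u \<noteq> v"
    using assms card_le_Suc0_iff_eq[of V] by (auto simp: star_system_def)
  then have "{u, v} \<in> edges (complete_graph V)"
    by simp
  then have "{u, v} \<in> (\<Union>S\<in>B. edges S)"
    using assms(1) by (simp add: star_system_def)
  then show ?thesis
    by blast
qed

lemma star_system_not_1_colourable:
  assumes "star_system e n V B" "n \<ge> 2"
  shows "\<not> colourable 1 V B"
proof
  assume "colourable 1 V B"
  then obtain C where "partition_on V {C}" and C: "\<forall>S\<in>B. \<not> verts S \<subseteq> C"
    by (auto simp: colourable_def is_colouring_def card_1_singleton_iff)
  then have "V = C"
    by (auto simp: partition_on_def)
  moreover obtain S where "S \<in> B" "verts S \<subseteq> V"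
    using assms star_system_blocks_nonempty[OF assms] by (auto simp: star_system_def subgraph_def)
  ultimately show False
    using C by blast
qed

theorem theorem3p1:
  fixes e :: nat
  assumes "e \<ge> 3"
  shows "\<exists>(V :: nat set) B. star_system e (2 * e) V B \<and>
           strongly_equitable_chromatic 2 V B \<and>
           (\<exists>P. is_colouring 2 V B P \<and> (\<forall>C\<in>P. card C = e))"
proof -
  obtain V :: "nat set" and B where system: "star_system e (2 * e) V B"
    using ex_star_system_of_double_order[of e] assms by auto
  obtain P where colouring: "is_colouring 2 V B P" and size: "\<forall>C\<in>P. card C = e"
    using ex_equitable_colouring[OF system] assms by auto
  have "chromatic 2 V B"
    using colouring star_system_not_1_colourable[OF system] assms
    by (auto simp: chromatic_def colourable_def)
  moreover have "strongly_equitable P"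
    using size by (simp add: strongly_equitable_def)
  ultimately show ?thesis
    using system colouring size by (auto simp: strongly_equitable_chromatic_def)
qed

end
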